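(* For every ordinal $\gamma$ with $1 \leq \gamma < \omega_1$, the classes $\boldsymbol{\Sigma}^0_\gamma$ and $\boldsymbol{\Pi}^0_\gamma$ of subsets of $2^{\mathbb{N}}$ satisfy $\boldsymbol{\Sigma}^0_\gamma \neq \boldsymbol{\Pi}^0_\gamma$.
   Context: $2^{\mathbb{N}}$ has the product topology. A set $S\subseteq 2^{\mathbb{N}}$ is $\boldsymbol{\Sigma}^0_0$ (equivalently $\boldsymbol{\Pi}^0_0$) if it is clopen. For $1\le\alpha<\omega_1$, a set is $\boldsymbol{\Sigma}^0_\alpha$ (resp. $\boldsymbol{\Pi}^0_\alpha$) if it is a countable union (resp. intersection) of sets $S_n$, $n\in\mathbb{N}$, each of which is $\boldsymbol{\Pi}^0_{\beta_n}$ (resp. $\boldsymbol{\Sigma}^0_{\beta_n}$) for some $\beta_n<\alpha$ (for $\alpha\geq 1$ this is the usual Borel hierarchy). *)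

theory Defs
  imports "HOL-Analysis.Analysis" "HOL-Library.Countable_Set_Type"
begin

text \<open>
  A well-order of type \<open>\<omega>\<^sub>1\<close> is the successor cardinal of \<^const>\<open>natLeq\<close>. As \<open>\<omega>\<^sub>1\<close> is the set of all
  ordinals below it, the elements of this type, with their order, are the countable ordinals. The
  underlying sets of naturals are mere labels. The lemmas \<open>countable_below\<close> and \<open>uncountable_ord1\<close>
  characterise the order type.
\<close>

typedef ord1 = "Field (cardSuc natLeq)"
  morphisms rep_ord1 abs_ord1
proof -
  have "Field (cardSuc natLeq) \<noteq> {}"
    using cardSuc_finite[OF natLeq_Card_order] Field_natLeq by auto
  then show ?thesis by blast
qed

lemma Well_order_cardSuc_natLeq: "Well_order (cardSuc natLeq)"
  using cardSuc_Card_order[OF natLeq_Card_order] card_order_on_well_order_on by blast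

instantiation ord1 :: wellorder
begin

definition less_eq_ord1 :: "ord1 \<Rightarrow> ord1 \<Rightarrow> bool"
  where "a \<le> b \<longleftrightarrow> (rep_ord1 a, rep_ord1 b) \<in> cardSuc natLeq"

definition less_ord1 :: "ord1 \<Rightarrow> ord1 \<Rightarrow> bool"
  where "(a :: ord1) < b \<longleftrightarrow> a \<le> b \<and> a \<noteq> b"

instance
proof -
  interpret wo_rel "cardSuc natLeq"
    by unfold_locales (rule Well_order_cardSuc_natLeq)
  have refl: "a \<le> a" for a :: ord1
    using REFL rep_ord1[of a] by (auto simp: less_eq_ord1_def refl_on_def)
  have trans: "a \<le> c" if "a \<le> b" "b \<le> c" for a b c :: ord1
    using TRANS that unfolding less_eq_ord1_def trans_def by blast
  have antisym: "a = b" if "a \<le> b" "b \<le> a" for a b :: ord1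
    using ANTISYM that unfolding less_eq_ord1_def
    by (auto dest: antisymD simp: rep_ord1_inject)
  have total: "a \<le> b \<or> b \<le> a" for a b :: ord1
    using TOTALS rep_ord1[of a] rep_ord1[of b] by (auto simp: less_eq_ord1_def)
  show "OFCLASS(ord1, wellorder_class)"
  proof
    fix P :: "ord1 \<Rightarrow> bool" and a
    assume step: "\<And>x. (\<And>y. y < x \<Longrightarrow> P y) \<Longrightarrow> P x"
    have "\<forall>a. rep_ord1 a = z \<longrightarrow> P a" for z
    proof (induction z rule: well_order_induct)
      case (1 z)
      have "P y" if "rep_ord1 a = z" "y < a" for a y
        using 1 that rep_ord1_inject[of y a] by (auto simp: less_ord1_def less_eq_ord1_def)
      then show ?case using step by blast
    qed
    then show "P a" by blast
  qed (use refl trans antisym total in \<open>auto simp: less_ord1_def\<close>)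
qed

end

lemma uncountable_ord1: "uncountable (UNIV :: ord1 set)"
proof
  include cardinal_syntax
  assume "countable (UNIV :: ord1 set)"
  then have "countable (Field (cardSuc natLeq))"
    using type_definition.Rep_range[OF type_definition_ord1] countable_image by metis
  then have "|Field (cardSuc natLeq)| \<le>o natLeq"
    by (simp add: countable_card_le_natLeq)
  then have "cardSuc natLeq \<le>o natLeq"
    using card_of_Field_ordIso[OF cardSuc_Card_order[OF natLeq_Card_order]]
      ordIso_ordLeq_trans ordIso_symmetric by blast
  then show False
    using cardSuc_greater[OF natLeq_Card_order] not_ordLess_ordLeq by blast
qed

lemma countable_below: "countable {..<a :: ord1}"
proof -
  include cardinal_syntax
  have "|underS (cardSuc natLeq) (rep_ord1 a)| <o cardSuc natLeq"
    by (rule card_of_underS[OF cardSuc_Card_order[OF natLeq_Card_order] rep_ord1])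
  then have "|underS (cardSuc natLeq) (rep_ord1 a)| \<le>o natLeq"
    using cardSuc_ordLeq_ordLess[OF natLeq_Card_order card_of_Card_order] by blast
  then have "countable (underS (cardSuc natLeq) (rep_ord1 a))"
    by (simp add: countable_card_le_natLeq)
  moreover have "rep_ord1 ` {..<a} \<subseteq> underS (cardSuc natLeq) (rep_ord1 a)"
    by (auto simp: underS_def less_ord1_def less_eq_ord1_def rep_ord1_inject)
  moreover have "inj_on rep_ord1 {..<a}"
    by (simp add: inj_on_def rep_ord1_inject)
  ultimately show ?thesis
    by (metis countable_image_inj_on countable_subset)
qed

instantiation ord1 :: "{zero, one}"
begin

definition zero_ord1 :: ord1
  where "0 = (LEAST a :: ord1. True)"

definition one_ord1 :: ord1
  where "1 = (LEAST a :: ord1. 0 < a)"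

instance ..

end

lemma zero_le_ord1: "0 \<le> (a :: ord1)"
  unfolding zero_ord1_def by (rule Least_le) simp

lemma one_le_ord1_iff: "1 \<le> (a :: ord1) \<longleftrightarrow> a \<noteq> 0"
proof -
  obtain b :: ord1 where "b \<noteq> 0"
    using uncountable_ord1 uncountable_infinite[of "UNIV :: ord1 set"] finite_subset[of UNIV "{0 :: ord1}"]
    by auto
  then have "0 < b" using zero_le_ord1[of b] by simp
  then have "(0 :: ord1) < 1"
    unfolding one_ord1_def by (rule LeastI)
  moreover have "1 \<le> a" if "0 < a"
    unfolding one_ord1_def using that by (rule Least_le)
  ultimately show ?thesis using zero_le_ord1[of a] by force
qed

text \<open>
  \<open>2\<^sup>\<nat>\<close> is the type \<^typ>\<open>nat \<Rightarrow> bool\<close>; its \<^const>\<open>open\<close> is the product topology of the discrete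
  topology on \<^typ>\<open>bool\<close>.
\<close>

context
  notes conj_cong [fundef_cong]
begin

function Sigma0 :: "ord1 \<Rightarrow> (nat \<Rightarrow> bool) set set"
  and Pi0 :: "ord1 \<Rightarrow> (nat \<Rightarrow> bool) set set" where
  "Sigma0 \<alpha> = (if \<alpha> = 0 then {S. open S \<and> closed S}
     else {(\<Union>n. S n) | S :: nat \<Rightarrow> (nat \<Rightarrow> bool) set. \<forall>n. \<exists>\<beta><\<alpha>. S n \<in> Pi0 \<beta>})"
| "Pi0 \<alpha> = (if \<alpha> = 0 then {S. open S \<and> closed S}
     else {(\<Inter>n. S n) | S :: nat \<Rightarrow> (nat \<Rightarrow> bool) set. \<forall>n. \<exists>\<beta><\<alpha>. S n \<in> Sigma0 \<beta>})"
  by pat_completeness auto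
termination
  by (relation "inv_image {(a, b). a < b} (case_sum id id)") (auto simp: wf)

end

declare Sigma0.simps [simp del] Pi0.simps [simp del]

end

theory Submission
  imports Defs
begin

text \<open>
  The proof is the classical diagonal argument. For \<open>\<alpha> \<noteq> 0\<close> there is a universal \<open>\<Sigma>\<close>-set of level
  \<open>\<alpha>\<close>: a family \<open>U\<close> of sets indexed by points of the Cantor space that lists all of \<^term>\<open>Sigma0 \<alpha>\<close>
  and whose graph \<open>{(x, y). y \<in> U x}\<close> is itself \<open>\<Sigma>\<close> of level \<open>\<alpha>\<close>. If \<open>\<Sigma>\<close> and \<open>\<Pi>\<close> agreed at
  level \<open>\<alpha>\<close>, the class would be closed under complements, so the anti-diagonal \<open>{x. x \<notin> U x}\<close>
  would be one of the sets \<open>U x\<close>, which is Russell's contradiction.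

  Universal sets are built by recursion on \<open>\<alpha>\<close>. As \<open>\<alpha>\<close> is countable, there is a fixed list of all
  smaller levels, and a code for a countable union lists, in its rows, codes for the complements of
  the sets in the union. The only obstacle is level \<open>0\<close>: the same diagonal argument shows that the
  clopen sets have no universal clopen set. But by compactness there are only countably many clopen
  sets, so they can be listed by a natural number instead. Allowing in every code an additional
  natural number therefore makes the recursion uniform (\<open>parametrization\<close>), and the union over all
  values of that number removes it again at each level above \<open>0\<close> (\<open>universal_from_below\<close>).
\<close>

section \<open>The Borel classes\<close>

lemma Sigma0_nonzero_iff:
  "\<alpha> \<noteq> 0 \<Longrightarrow> S \<in> Sigma0 \<alpha> \<longleftrightarrow>
    (\<exists>T :: nat \<Rightarrow> (nat \<Rightarrow> bool) set. S = (\<Union>n. T n) \<and> (\<forall>n. \<exists>\<beta><\<alpha>. T n \<in> Pi0 \<beta>))"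
  by (subst Sigma0.simps) simp

lemma Pi0_nonzero_iff:
  "\<alpha> \<noteq> 0 \<Longrightarrow> S \<in> Pi0 \<alpha> \<longleftrightarrow>
    (\<exists>T :: nat \<Rightarrow> (nat \<Rightarrow> bool) set. S = (\<Inter>n. T n) \<and> (\<forall>n. \<exists>\<beta><\<alpha>. T n \<in> Sigma0 \<beta>))"
  by (subst Pi0.simps) simp

text \<open>This reindexing makes unions over triples of naturals available for universal sets.\<close>

lemma Sigma0_UN:
  fixes S :: "'i :: countable \<Rightarrow> (nat \<Rightarrow> bool) set"
  assumes "\<alpha> \<noteq> 0" and "\<And>i. \<exists>\<beta><\<alpha>. S i \<in> Pi0 \<beta>"
  shows "(\<Union>i. S i) \<in> Sigma0 \<alpha>"
proof -
  have "(\<Union>i. S i) = (\<Union>n. S (from_nat n))"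
    by (metis UN_extend_simps(10) surj_from_nat)
  then show ?thesis
    unfolding Sigma0_nonzero_iff[OF assms(1)] using assms(2) by blast
qed

text \<open>
  The two equivalences are proved together because each level of one class is built from lower
  levels of the other.
\<close>

lemma Sigma0_Pi0_complement: "(S \<in> Sigma0 \<alpha> \<longleftrightarrow> - S \<in> Pi0 \<alpha>) \<and> (S \<in> Pi0 \<alpha> \<longleftrightarrow> - S \<in> Sigma0 \<alpha>)"
proof (induction \<alpha> arbitrary: S rule: less_induct)
  case (less \<alpha>)
  show ?case
  proof (cases "\<alpha> = 0")
    case True
    then show ?thesis
      by (auto simp: Sigma0.simps[of 0] Pi0.simps[of 0] open_closed[of S] closed_open[of S])
  next
    case False
    have Sigma_to_Pi: "- S \<in> Pi0 \<alpha>" if S: "S \<in> Sigma0 \<alpha>" for S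
    proof -
      obtain T :: "nat \<Rightarrow> (nat \<Rightarrow> bool) set" where T: "S = (\<Union>n. T n)" "\<forall>n. \<exists>\<beta><\<alpha>. T n \<in> Pi0 \<beta>"
        using S unfolding Sigma0_nonzero_iff[OF False] by blast
      have "- S = (\<Inter>n. - T n)"
        using T(1) by simp
      moreover have "\<forall>n. \<exists>\<beta><\<alpha>. - T n \<in> Sigma0 \<beta>"
        using T(2) less.IH by blast
      ultimately show ?thesis
        unfolding Pi0_nonzero_iff[OF False] by blast
    qed
    have Pi_to_Sigma: "- S \<in> Sigma0 \<alpha>" if S: "S \<in> Pi0 \<alpha>" for S
    proof -
      obtain T :: "nat \<Rightarrow> (nat \<Rightarrow> bool) set" where T: "S = (\<Inter>n. T n)" "\<forall>n. \<exists>\<beta><\<alpha>. T n \<in> Sigma0 \<beta>"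
        using S unfolding Pi0_nonzero_iff[OF False] by blast
      have "- S = (\<Union>n. - T n)"
        using T(1) by simp
      moreover have "\<forall>n. \<exists>\<beta><\<alpha>. - T n \<in> Pi0 \<beta>"
        using T(2) less.IH by blast
      ultimately show ?thesis
        unfolding Sigma0_nonzero_iff[OF False] by blast
    qed
    show ?thesis
      using Sigma_to_Pi Pi_to_Sigma by (metis double_complement)
  qed
qed

lemma Pi0_iff_Compl_Sigma0: "S \<in> Pi0 \<alpha> \<longleftrightarrow> - S \<in> Sigma0 \<alpha>"
  using Sigma0_Pi0_complement by blast

lemma UNIV_in_Sigma0: "UNIV \<in> Sigma0 \<alpha>"
proof (cases "\<alpha> = 0")
  case True
  then show ?thesis by (simp add: Sigma0.simps)
next
  case False
  have "UNIV \<in> Pi0 0" by (simp add: Pi0.simps)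
  moreover have "0 < \<alpha>" using False zero_le_ord1[of \<alpha>] by simp
  ultimately have "(\<Union>n::nat. UNIV) \<in> Sigma0 \<alpha>"
    using False by (intro Sigma0_UN) auto
  then show ?thesis by simp
qed

section \<open>Clopen subsets of the Cantor space\<close>

lemma compact_cantor_space: "compact (UNIV :: (nat \<Rightarrow> bool) set)"
proof -
  have "compact_space (euclidean :: bool topology)"
    by (simp add: compact_space_def finite_imp_compact)
  then have "compact_space (product_topology (\<lambda>_::nat. euclidean :: bool topology) UNIV)"
    by (simp add: compact_space_product_topology)
  then show ?thesis
    by (simp add: euclidean_product_topology compact_space_def)
qed

instance bool :: second_countable_topology
proof
  have "open = generate_topology (UNIV :: bool set set)"
    by (auto simp: fun_eq_iff open_discrete intro: generate_topology.Basis)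
  then show "\<exists>B :: bool set set. countable B \<and> open = generate_topology B"
    by (intro exI[of _ UNIV]) (simp add: countable_finite)
qed

text \<open>
  A clopen set is compact, hence a union of finitely many members of a countable base.
\<close>

lemma countable_clopen_cantor_space:
  "countable {S :: (nat \<Rightarrow> bool) set. open S \<and> closed S}"
proof -
  obtain B :: "(nat \<Rightarrow> bool) set set" where B: "countable B" "topological_basis B"
    using ex_countable_basis[where 'a = "nat \<Rightarrow> bool"] by blast
  have "S \<in> Union ` {F. finite F \<and> F \<subseteq> B}" if S: "open S" "closed S" for S
  proof -
    obtain C where C: "C \<subseteq> B" "S = \<Union>C"
      using B(2) S(1) unfolding topological_basis_def by metis
    have "compact S"
      using closed_Int_compact[OF S(2) compact_cantor_space] by simp
    moreover have "open T" if "T \<in> C" for T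
      using that C(1) topological_basis_open[OF B(2)] by blast
    ultimately obtain F where F: "F \<subseteq> C" "finite F" "S \<subseteq> \<Union>F"
      using C(2) by (metis compactE order_refl)
    then have "S = \<Union>F" using C(2) by blast
    moreover have "F \<in> {F. finite F \<and> F \<subseteq> B}" using F C(1) by blast
    ultimately show ?thesis by (rule image_eqI)
  qed
  moreover have "countable {F. finite F \<and> F \<subseteq> B}"
    using B(1) by (rule countable_Collect_finite_subset)
  ultimately show ?thesis
    using countable_subset[OF _ countable_image] by (metis (no_types, lifting) mem_Collect_eq subsetI)
qed

section \<open>Universal sets\<close>

text \<open>
  Quantifying over continuous \<open>f\<close> and \<open>g\<close> expresses that the graph of \<open>U\<close> is \<open>\<Sigma>\<close> of level \<open>\<alpha>\<close>
  without introducing the classes on \<open>2\<^sup>\<nat> \<times> 2\<^sup>\<nat>\<close>: every continuous preimage of the graph is \<open>\<Sigma>\<close>.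
  The diagonal arises with \<open>f\<close> and \<open>g\<close> the identity; in the recursion \<open>f\<close> is composed with the
  continuous map that extracts a row from a code.
\<close>

definition Sigma0_graph :: "ord1 \<Rightarrow> ((nat \<Rightarrow> bool) \<Rightarrow> (nat \<Rightarrow> bool) set) \<Rightarrow> bool"
  where "Sigma0_graph \<alpha> U \<longleftrightarrow>
    (\<forall>f g. continuous_on UNIV f \<and> continuous_on UNIV g \<longrightarrow> {z. g z \<in> U (f z)} \<in> Sigma0 \<alpha>)"

lemma Sigma0_graphD:
  "Sigma0_graph \<alpha> U \<Longrightarrow> continuous_on UNIV f \<Longrightarrow> continuous_on UNIV g \<Longrightarrow>
    {z. g z \<in> U (f z)} \<in> Sigma0 \<alpha>"
  by (simp add: Sigma0_graph_def)

definition universal :: "ord1 \<Rightarrow> ((nat \<Rightarrow> bool) \<Rightarrow> (nat \<Rightarrow> bool) set) \<Rightarrow> bool"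
  where "universal \<alpha> U \<longleftrightarrow> Sigma0_graph \<alpha> U \<and> Sigma0 \<alpha> \<subseteq> range U"

text \<open>
  Here a code is a pair of a natural number \<open>k\<close>, the discrete parameter, and a point of the Cantor
  space. The requirement on \<^const>\<open>UNIV\<close> provides, for every \<open>k\<close>, a code that contributes nothing
  to a union of complements.
\<close>

definition parametrization :: "ord1 \<Rightarrow> (nat \<Rightarrow> (nat \<Rightarrow> bool) \<Rightarrow> (nat \<Rightarrow> bool) set) \<Rightarrow> bool"
  where "parametrization \<alpha> V \<longleftrightarrow>
    (\<forall>k. Sigma0_graph \<alpha> (V k)) \<and> Sigma0 \<alpha> \<subseteq> (\<Union>k. range (V k)) \<and> (\<forall>k. UNIV \<in> range (V k))"

lemma parametrization_universal: "universal \<alpha> U \<Longrightarrow> parametrization \<alpha> (\<lambda>_. U)"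
  using UNIV_in_Sigma0[of \<alpha>] by (auto simp: universal_def parametrization_def)

lemma parametrization_0: "\<exists>V. parametrization 0 V"
proof -
  define C :: "nat \<Rightarrow> (nat \<Rightarrow> bool) set" where "C = from_nat_into {S. open S \<and> closed S}"
  have "{S :: (nat \<Rightarrow> bool) set. open S \<and> closed S} \<noteq> {}" by blast
  then have C: "range C = {S. open S \<and> closed S}"
    unfolding C_def using countable_clopen_cantor_space by (rule range_from_nat_into)
  \<comment> \<open>The first bit of the code switches between the clopen set and the whole space.\<close>
  define V where "V k x = (if x 0 then C k else UNIV)" for k and x :: "nat \<Rightarrow> bool"
  have "Sigma0_graph 0 (V k)" for k
    unfolding Sigma0_graph_def
  proof (intro allI impI, elim conjE)
    fix f g :: "(nat \<Rightarrow> bool) \<Rightarrow> nat \<Rightarrow> bool"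
    assume f: "continuous_on UNIV f" and g: "continuous_on UNIV g"
    have f0: "continuous_on UNIV (\<lambda>z. f z 0)"
      using f by (rule continuous_on_product_then_coordinatewise)
    have Ck: "open (C k)" "closed (C k)" using C by blast+
    have "{z. g z \<in> V k (f z)} = (\<lambda>z. f z 0) -` {False} \<union> g -` C k"
      by (auto simp: V_def)
    moreover have "open \<dots>"
      using Ck f0 g by (intro open_Un open_vimage open_discrete)
    moreover have "closed ((\<lambda>z. f z 0) -` {False} \<union> g -` C k)"
      using Ck f0 g by (intro closed_Un closed_vimage) auto
    ultimately show "{z. g z \<in> V k (f z)} \<in> Sigma0 0"
      by (simp add: Sigma0.simps)
  qed
  moreover have "UNIV \<in> range (V k)" for k
    by (rule range_eqI[of _ _ "\<lambda>_. False"]) (simp add: V_def)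
  moreover have "Sigma0 0 \<subseteq> (\<Union>k. range (V k))"
  proof
    fix S
    assume "S \<in> Sigma0 0"
    then have "S \<in> range C" by (simp add: C Sigma0.simps)
    then obtain k where "S = C k" by blast
    then have "S = V k (\<lambda>_. True)" by (simp add: V_def)
    then show "S \<in> (\<Union>k. range (V k))" by blast
  qed
  ultimately have "parametrization 0 V"
    by (simp add: parametrization_def)
  then show ?thesis
    by (rule exI[of _ V])
qed

text \<open>
  These are the coordinates of the homeomorphism (up to unused bits) of the Cantor space with its
  power by a countable index type; they let a single point store countably many codes.
\<close>

definition row :: "'i :: countable \<Rightarrow> (nat \<Rightarrow> bool) \<Rightarrow> nat \<Rightarrow> bool"
  where "row i x = (\<lambda>l. x (to_nat (i, l)))"

lemma continuous_on_row:
  assumes "continuous_on UNIV f"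
  shows "continuous_on UNIV (\<lambda>z. row i (f z))"
  unfolding row_def
  by (intro continuous_on_coordinatewise_then_product
      continuous_on_product_then_coordinatewise[OF assms])

lemma ex_rows: "\<exists>x. \<forall>i. row i x = y i"
proof
  show "\<forall>i. row i (\<lambda>n. case from_nat n of (i, l) \<Rightarrow> y i l) = y i"
    by (simp add: row_def)
qed

text \<open>
  A code of a union chooses, for its \<open>n\<close>-th set, the \<open>m\<close>-th level in a list of all levels below
  \<open>\<alpha>\<close> and a discrete parameter \<open>k\<close>, and stores a code for the complement of the set in the row with
  index \<open>(m, k, n)\<close>. All rows that are not chosen are filled with codes of the whole space. Thus
  \<open>m\<close> and \<open>k\<close> are fixed on each row, and the graph restricted to
  a row has a definite level below \<open>\<alpha>\<close>.
\<close>

lemma universal_from_below: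
  assumes "\<alpha> \<noteq> 0" and below: "\<And>\<beta>. \<beta> < \<alpha> \<Longrightarrow> \<exists>V. parametrization \<beta> V"
  shows "\<exists>U. universal \<alpha> U"
proof -
  obtain V where V: "\<And>\<beta>. \<beta> < \<alpha> \<Longrightarrow> parametrization \<beta> (V \<beta>)"
    using below by metis
  define e :: "nat \<Rightarrow> ord1" where "e = from_nat_into {..<\<alpha>}"
  have "0 \<in> {..<\<alpha>}" using assms(1) zero_le_ord1[of \<alpha>] by simp
  then have e: "range e = {..<\<alpha>}"
    unfolding e_def using countable_below by (intro range_from_nat_into) auto
  then have e_less: "e m < \<alpha>" for m
    using rangeI[of e m] by simp
  have V_graph: "Sigma0_graph (e m) (V (e m) k)"
    and V_UNIV: "\<exists>y. V (e m) k y = UNIV" for m k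
    using V[OF e_less[of m]] unfolding parametrization_def by (simp, metis rangeE)
  have V_onto: "\<exists>k y. A = V (e m) k y" if "A \<in> Sigma0 (e m)" for A m
    using V[OF e_less[of m]] that unfolding parametrization_def by blast
  define U where "U x = (\<Union>(m, k, n :: nat). - V (e m) k (row (m, k, n) x))" for x
  have "Sigma0_graph \<alpha> U"
    unfolding Sigma0_graph_def
  proof (intro allI impI, elim conjE)
    fix f g :: "(nat \<Rightarrow> bool) \<Rightarrow> nat \<Rightarrow> bool"
    assume f: "continuous_on UNIV f" and g: "continuous_on UNIV g"
    define T where "T = (\<lambda>(m, k, n :: nat). - {z. g z \<in> V (e m) k (row (m, k, n) (f z))})"
    have "T (m, k, n) \<in> Pi0 (e m)" for m k n
    proof -
      have "{z. g z \<in> V (e m) k (row (m, k, n) (f z))} \<in> Sigma0 (e m)"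
        using V_graph continuous_on_row[OF f] g by (rule Sigma0_graphD)
      then show ?thesis by (simp add: T_def Pi0_iff_Compl_Sigma0)
    qed
    then have "\<exists>\<beta><\<alpha>. T i \<in> Pi0 \<beta>" for i
      using e_less by (metis prod_cases3)
    with assms(1) have "(\<Union>i. T i) \<in> Sigma0 \<alpha>"
      by (rule Sigma0_UN)
    moreover have "{z. g z \<in> U (f z)} = (\<Union>i. T i)"
      by (auto simp: U_def T_def)
    ultimately show "{z. g z \<in> U (f z)} \<in> Sigma0 \<alpha>" by simp
  qed
  moreover have "S \<in> range U" if S: "S \<in> Sigma0 \<alpha>" for S
  proof -
    obtain T :: "nat \<Rightarrow> (nat \<Rightarrow> bool) set" where T: "S = (\<Union>n. T n)" "\<forall>n. \<exists>\<beta><\<alpha>. T n \<in> Pi0 \<beta>"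
      using S unfolding Sigma0_nonzero_iff[OF assms(1)] by blast
    have "\<exists>m k y. - T n = V (e m) k y" for n
    proof -
      obtain \<beta> where "\<beta> < \<alpha>" "T n \<in> Pi0 \<beta>"
        using T(2) by blast
      moreover from this(1) have "\<beta> \<in> range e" by (simp add: e)
      ultimately obtain m where "T n \<in> Pi0 (e m)" by blast
      then have "- T n \<in> Sigma0 (e m)" by (simp add: Pi0_iff_Compl_Sigma0)
      then show ?thesis using V_onto by blast
    qed
    then obtain m k y where code: "\<And>n. - T n = V (e (m n)) (k n) (y n)"
      by metis
    obtain fill where fill: "\<And>m k. V (e m) k (fill m k) = UNIV"
      using V_UNIV by metis
    obtain x where
      "\<forall>i. row i x = (\<lambda>(m', k', n). if m' = m n \<and> k' = k n then y n else fill m' k') i"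
      using ex_rows by blast
    then have x: "row (m', k', n) x = (if m' = m n \<and> k' = k n then y n else fill m' k')"
      for m' k' n by simp
    have V_x: "V (e m') k' (row (m', k', n) x) = (if m' = m n \<and> k' = k n then - T n else UNIV)"
      for m' k' n by (simp add: x fill code)
    have "U x = S"
      unfolding U_def V_x T(1) by (auto split: if_splits)
    then show ?thesis by blast
  qed
  ultimately show ?thesis
    unfolding universal_def by blast
qed

lemma ex_parametrization: "\<exists>V. parametrization \<alpha> V"
proof (induction \<alpha> rule: less_induct)
  case (less \<alpha>)
  show ?case
  proof (cases "\<alpha> = 0")
    case True
    then show ?thesis using parametrization_0 by simp
  next
    case False
    then show ?thesis
      using universal_from_below less parametrization_universal by metis
  qed
qed

section \<open>The diagonal argument\<close>

theorem theorem4p1: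
  fixes \<gamma> :: ord1
  assumes "1 \<le> \<gamma>"
  shows "Sigma0 \<gamma> \<noteq> Pi0 \<gamma>"
proof
  assume eq: "Sigma0 \<gamma> = Pi0 \<gamma>"
  have "\<gamma> \<noteq> 0" using assms by (simp add: one_le_ord1_iff)
  then obtain U where U: "universal \<gamma> U"
    using universal_from_below[OF _ ex_parametrization] by blast
  then have "Sigma0_graph \<gamma> U"
    by (simp add: universal_def)
  then have "{z. z \<in> U z} \<in> Sigma0 \<gamma>"
    using continuous_on_id continuous_on_id by (rule Sigma0_graphD)
  then have "- {z. z \<in> U z} \<in> Sigma0 \<gamma>"
    using Pi0_iff_Compl_Sigma0[of "{z. z \<in> U z}" \<gamma>] eq by simp
  then obtain x where "- {z. z \<in> U z} = U x"
    using U unfolding universal_def by blast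
  then show False by blast
qed

end
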